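(* A finite integral connectivity space $X$ is characterised, up to isomorphism, by its generic graph $G_X$ (defined up to isomorphism). That is, for finite integral connectivity spaces $X$ and $Y$, $X$ and $Y$ are isomorphic connectivity spaces if and only if $G_X$ and $G_Y$ are isomorphic directed graphs.
   Context: A connectivity structure on a set $S$ is a set $\mathcal{K}$ of subsets of $S$ with $\emptyset\in\mathcal{K}$ such that for every $\mathcal{I}\subseteq\mathcal{K}$, if $\bigcap_{K\in\mathcal{I}}K\neq\emptyset$ then $\bigcup_{K\in\mathcal{I}}K\in\mathcal{K}$. A connectivity space $X=(|X|,\kappa(X))$ is a set $|X|$ with a connectivity structure $\kappa(X)$, whose elements are called connected subsets; it is integral if all singletons are connected and finite if $|X|$ is finite. A connectivity morphism is a function sending connected subsets to connected subsets; isomorphisms are bijections that are connectivity morphisms in both directions. For a set $\mathcal{A}$ of subsets of $S$, $[\mathcal{A}]_0$ is the smallest connectivity structure on $S$ containing $\mathcal{A}$. A connected subset $K$ of $X$ is reducible if $K\in[\kappa(X)\setminus\{K\}]_0$; a nonempty connected subset is irreducible if it is not reducible. For $X$ finite integral, a generic point of $X$ is a non-empty irreducible connected subset of $X$. The generic graph $G_X$ is the directed graph whose vertices are the generic points of $X$, with a directed edge $g\to h$ iff $g\supsetneqq h$ and there is no generic point $k$ with $g\supsetneqq k\supsetneqq h$. *)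

theory Defs
  imports "Graph_Theory.Pair_Digraph" "Graph_Theory.Digraph_Isomorphism"
begin

(* The empty family is harmless: the intersection of {} is UNIV, so the condition for it
   only says that {} is in \<K>, which is required anyway. *)
definition connectivity_structure :: "'a set \<Rightarrow> 'a set set \<Rightarrow> bool" where
  "connectivity_structure S \<K> \<longleftrightarrow>
     \<K> \<subseteq> Pow S \<and> {} \<in> \<K> \<and> (\<forall>\<I>. \<I> \<subseteq> \<K> \<longrightarrow> \<Inter>\<I> \<noteq> {} \<longrightarrow> \<Union>\<I> \<in> \<K>)"

record 'a conn_space =
  points :: "'a set"
  conn_sets :: "'a set set"

definition connectivity_space :: "'a conn_space \<Rightarrow> bool" where
  "connectivity_space X \<longleftrightarrow> connectivity_structure (points X) (conn_sets X)"

definition integral_space :: "'a conn_space \<Rightarrow> bool" where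
  "integral_space X \<longleftrightarrow> (\<forall>x\<in>points X. {x} \<in> conn_sets X)"

definition finite_space :: "'a conn_space \<Rightarrow> bool" where
  "finite_space X \<longleftrightarrow> finite (points X)"

definition conn_morphism :: "'a conn_space \<Rightarrow> 'b conn_space \<Rightarrow> ('a \<Rightarrow> 'b) \<Rightarrow> bool" where
  "conn_morphism X Y f \<longleftrightarrow>
     f ` points X \<subseteq> points Y \<and> (\<forall>K\<in>conn_sets X. f ` K \<in> conn_sets Y)"

definition conn_isomorphism :: "'a conn_space \<Rightarrow> 'b conn_space \<Rightarrow> ('a \<Rightarrow> 'b) \<Rightarrow> bool" where
  "conn_isomorphism X Y f \<longleftrightarrow>
     bij_betw f (points X) (points Y) \<and> conn_morphism X Y f \<and>
     conn_morphism Y X (the_inv_into (points X) f)"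

definition conn_isomorphic :: "'a conn_space \<Rightarrow> 'b conn_space \<Rightarrow> bool" where
  "conn_isomorphic X Y \<longleftrightarrow> (\<exists>f. conn_isomorphism X Y f)"

(* [\<A>]_0, the smallest connectivity structure on S containing \<A> *)
definition generated_structure :: "'a set \<Rightarrow> 'a set set \<Rightarrow> 'a set set" where
  "generated_structure S \<A> = \<Inter>{\<K>. connectivity_structure S \<K> \<and> \<A> \<subseteq> \<K>}"

lemma connectivity_structure_Pow: "connectivity_structure S (Pow S)"
  unfolding connectivity_structure_def by blast

lemma connectivity_structure_generated:
  assumes "\<A> \<subseteq> Pow S"
  shows "connectivity_structure S (generated_structure S \<A>)"
  unfolding connectivity_structure_def
proof (intro conjI allI impI)
  show "generated_structure S \<A> \<subseteq> Pow S"
    using assms connectivity_structure_Pow unfolding generated_structure_def by blast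
  show "{} \<in> generated_structure S \<A>"
    unfolding generated_structure_def connectivity_structure_def by blast
  fix \<I> assume I: "\<I> \<subseteq> generated_structure S \<A>" "\<Inter>\<I> \<noteq> {}"
  have "\<Union>\<I> \<in> \<K>" if K: "connectivity_structure S \<K>" "\<A> \<subseteq> \<K>" for \<K>
  proof -
    have "\<I> \<subseteq> \<K>" using I(1) K unfolding generated_structure_def by blast
    with K(1) I(2) show ?thesis unfolding connectivity_structure_def by simp
  qed
  then show "\<Union>\<I> \<in> generated_structure S \<A>" unfolding generated_structure_def by blast
qed

lemma generated_structure_contains: "\<A> \<subseteq> generated_structure S \<A>"
  unfolding generated_structure_def by blast

lemma generated_structure_least:
  "connectivity_structure S \<K> \<Longrightarrow> \<A> \<subseteq> \<K> \<Longrightarrow> generated_structure S \<A> \<subseteq> \<K>"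
  unfolding generated_structure_def by blast

definition conn_reducible :: "'a conn_space \<Rightarrow> 'a set \<Rightarrow> bool" where
  "conn_reducible X K \<longleftrightarrow>
     K \<in> conn_sets X \<and> K \<in> generated_structure (points X) (conn_sets X - {K})"

definition conn_irreducible :: "'a conn_space \<Rightarrow> 'a set \<Rightarrow> bool" where
  "conn_irreducible X K \<longleftrightarrow> K \<in> conn_sets X \<and> K \<noteq> {} \<and> \<not> conn_reducible X K"

definition generic_points :: "'a conn_space \<Rightarrow> 'a set set" where
  "generic_points X = {K. conn_irreducible X K}"

definition generic_graph :: "'a conn_space \<Rightarrow> 'a set pair_pre_digraph" where
  "generic_graph X = \<lparr>
     pverts = generic_points X,
     parcs = {(g, h). g \<in> generic_points X \<and> h \<in> generic_points X \<and> h \<subset> g \<and>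
                (\<nexists>k. k \<in> generic_points X \<and> h \<subset> k \<and> k \<subset> g)} \<rparr>"

end

theory Submission
  imports Defs
begin

text \<open>
  In a finite space every connected set lies in the structure generated by the generic points:
  a reducible connected set is generated by its proper connected subsets, so induction on the
  cardinality applies. The generic graph is the Hasse diagram of the generic points ordered by
  inclusion, and finiteness recovers that order from it. In an integral space the minimal generic
  points are the singletons, so an order isomorphism of generic points induces a bijection
  of the underlying sets; it acts on each generic point as the direct image, hence respects
  the generated structures.
\<close>

section \<open>Images of generated connectivity structures\<close>

text \<open>Direct image commutes with unions, and a point common to a family is sent to a point
  common to the images. The pulled-back structure turns minimality of
  \<open>generated_structure\<close> into an induction principle for images.\<close>

lemma connectivity_structure_vimage:
  assumes "connectivity_structure T \<K>" and "f ` S \<subseteq> T"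
  shows "connectivity_structure S {L. L \<subseteq> S \<and> f ` L \<in> \<K>}"
  unfolding connectivity_structure_def
proof (intro conjI allI impI)
  show "{} \<in> {L. L \<subseteq> S \<and> f ` L \<in> \<K>}"
    using assms(1) by (simp add: connectivity_structure_def)
  fix \<I> assume I: "\<I> \<subseteq> {L. L \<subseteq> S \<and> f ` L \<in> \<K>}" "\<Inter>\<I> \<noteq> {}"
  have "(`) f ` \<I> \<subseteq> \<K>" "\<Inter>((`) f ` \<I>) \<noteq> {}"
    using I by blast+
  then have "\<Union>((`) f ` \<I>) \<in> \<K>"
    using assms(1) by (simp add: connectivity_structure_def)
  then have "f ` \<Union>\<I> \<in> \<K>"
    by (simp add: image_Union)
  then show "\<Union>\<I> \<in> {L. L \<subseteq> S \<and> f ` L \<in> \<K>}"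
    using I(1) by blast
qed auto

text \<open>The sets with image in \<open>\<K>\<close> form a connectivity structure containing the
  generators, hence the structure they generate: images need to be checked on generators
  only.\<close>

lemma image_generated_structure:
  assumes "connectivity_structure T \<K>" and "f ` S \<subseteq> T" and "\<A> \<subseteq> Pow S"
    and "\<And>L. L \<in> \<A> \<Longrightarrow> f ` L \<in> \<K>" and "K \<in> generated_structure S \<A>"
  shows "f ` K \<in> \<K>"
proof -
  have "generated_structure S \<A> \<subseteq> {L. L \<subseteq> S \<and> f ` L \<in> \<K>}"
    using assms(3,4)
    by (intro generated_structure_least connectivity_structure_vimage[OF assms(1,2)]) blast
  with assms(5) show ?thesis by blast
qed

section \<open>Connected sets and generic points\<close>

lemma conn_sets_subset:
  "connectivity_space X \<Longrightarrow> K \<in> conn_sets X \<Longrightarrow> K \<subseteq> points X"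
  unfolding connectivity_space_def connectivity_structure_def by blast

lemma Union_conn_sets:
  "connectivity_space X \<Longrightarrow> \<I> \<subseteq> conn_sets X \<Longrightarrow> \<Inter>\<I> \<noteq> {} \<Longrightarrow> \<Union>\<I> \<in> conn_sets X"
  unfolding connectivity_space_def connectivity_structure_def by blast

lemma generic_points_conn_sets: "generic_points X \<subseteq> conn_sets X"
  by (auto simp: generic_points_def conn_irreducible_def)

lemma generic_points_nonempty: "g \<in> generic_points X \<Longrightarrow> g \<noteq> {}"
  by (auto simp: generic_points_def conn_irreducible_def)

lemma generic_points_subset:
  "connectivity_space X \<Longrightarrow> g \<in> generic_points X \<Longrightarrow> g \<subseteq> points X"
  using generic_points_conn_sets conn_sets_subset by blast

text \<open>A union equal to \<open>{x}\<close> already has \<open>{x}\<close> among its members.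
  Hence discarding \<open>{x}\<close> from the connected sets leaves a connectivity structure, and
  the other connected sets cannot generate it.\<close>

lemma singleton_generic_point:
  assumes X: "connectivity_space X" and "integral_space X" and x: "x \<in> points X"
  shows "{x} \<in> generic_points X"
proof -
  have "connectivity_structure (points X) (conn_sets X - {{x}})"
    unfolding connectivity_structure_def
  proof (intro conjI allI impI)
    show "conn_sets X - {{x}} \<subseteq> Pow (points X)"
      using X conn_sets_subset by blast
    show "{} \<in> conn_sets X - {{x}}"
      using X by (simp add: connectivity_space_def connectivity_structure_def)
    fix \<I> assume I: "\<I> \<subseteq> conn_sets X - {{x}}" "\<Inter>\<I> \<noteq> {}"
    have "\<Union>\<I> \<noteq> {x}"
    proof
      assume eq: "\<Union>\<I> = {x}"
      then obtain L where L: "L \<in> \<I>" "x \<in> L" by blast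
      with eq have "L = {x}" by blast
      with L I(1) show False by blast
    qed
    moreover have "\<Union>\<I> \<in> conn_sets X"
      using I by (intro Union_conn_sets[OF X]) auto
    ultimately show "\<Union>\<I> \<in> conn_sets X - {{x}}" by blast
  qed
  then have "generated_structure (points X) (conn_sets X - {{x}}) \<subseteq> conn_sets X - {{x}}"
    by (rule generated_structure_least) simp
  then show ?thesis
    using assms by (auto simp: generic_points_def conn_irreducible_def conn_reducible_def
        integral_space_def)
qed

section \<open>Generation of the connected sets by the generic points\<close>

text \<open>A union that equals \<open>K\<close> without having \<open>K\<close> as a member
  consists of proper subsets of \<open>K\<close>, so larger connected sets cannot help to generate
  \<open>K\<close>.\<close>

lemma reducible_generated_by_proper_subsets:
  assumes X: "connectivity_space X" and K: "conn_reducible X K"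
    and \<G>: "connectivity_structure (points X) \<G>"
    and proper: "\<And>L. L \<in> conn_sets X \<Longrightarrow> L \<subset> K \<Longrightarrow> L \<in> \<G>"
  shows "K \<in> \<G>"
proof -
  \<comment> \<open>The implication covers two cases at once: \<open>?A\<close> is all of
    \<open>conn_sets X\<close> if \<open>K\<close> is in \<open>\<G>\<close>, and
    \<open>conn_sets X - {K}\<close> otherwise. Both contain the generators of the reducibility
    condition, and \<open>K\<close> belongs to \<open>?A\<close> only in the first case.\<close>
  let ?A = "{L \<in> conn_sets X. L = K \<longrightarrow> K \<in> \<G>}"
  have "connectivity_structure (points X) ?A"
    unfolding connectivity_structure_def
  proof (intro conjI allI impI)
    show "?A \<subseteq> Pow (points X)"
      using X conn_sets_subset by blast
    show "{} \<in> ?A"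
      using X \<G> by (auto simp: connectivity_space_def connectivity_structure_def)
    fix \<I> assume I: "\<I> \<subseteq> ?A" "\<Inter>\<I> \<noteq> {}"
    have "\<Union>\<I> \<in> conn_sets X"
      using I by (intro Union_conn_sets[OF X]) auto
    moreover have "K \<in> \<G>" if eq: "\<Union>\<I> = K"
    proof (cases "K \<in> \<I>")
      case True
      then show ?thesis using I(1) by blast
    next
      case False
      have "\<I> \<subseteq> \<G>"
      proof
        fix L assume L: "L \<in> \<I>"
        with eq False have "L \<subset> K" by blast
        with L I(1) show "L \<in> \<G>" by (blast intro: proper)
      qed
      then show ?thesis
        using \<G> I(2) eq by (auto simp: connectivity_structure_def)
    qed
    ultimately show "\<Union>\<I> \<in> ?A" by blast
  qed
  then have "generated_structure (points X) (conn_sets X - {K}) \<subseteq> ?A"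
    by (rule generated_structure_least) blast
  then show ?thesis
    using K by (auto simp: conn_reducible_def)
qed

lemma conn_sets_generated_by_generic_points:
  assumes X: "connectivity_space X" and fin: "finite_space X" and "K \<in> conn_sets X"
  shows "K \<in> generated_structure (points X) (generic_points X)"
  using assms(3)
proof (induction "card K" arbitrary: K rule: less_induct)
  case less
  let ?\<G> = "generated_structure (points X) (generic_points X)"
  have \<G>: "connectivity_structure (points X) ?\<G>"
    using X generic_points_subset by (intro connectivity_structure_generated) blast
  consider "K = {}" | "conn_irreducible X K" | "conn_reducible X K"
    using less.prems by (auto simp: conn_irreducible_def)
  then show ?case
  proof cases
    case 1
    then show ?thesis using \<G> by (simp add: connectivity_structure_def)
  next
    case 2
    then show ?thesis
      using generated_structure_contains by (fastforce simp: generic_points_def)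
  next
    case 3
    \<comment> \<open>Finiteness makes \<open>card\<close> strictly decrease on proper subsets, as
      the induction hypothesis requires.\<close>
    have "finite K"
      using conn_sets_subset[OF X less.prems] fin finite_subset
      by (auto simp: finite_space_def)
    then show ?thesis
      by (intro reducible_generated_by_proper_subsets[OF X 3 \<G>] less.hyps psubset_card_mono)
  qed
qed

text \<open>The generic points of \<open>X\<close> generate its connected sets and
  \<open>conn_sets Y\<close> is itself a connectivity structure, so preservation propagates from the
  generators.\<close>

lemma conn_morphism_if_generic_points:
  assumes "connectivity_space X" and "finite_space X" and "connectivity_space Y"
    and "f ` points X \<subseteq> points Y"
    and "\<And>g. g \<in> generic_points X \<Longrightarrow> f ` g \<in> conn_sets Y"
  shows "conn_morphism X Y f"
  unfolding conn_morphism_def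
proof (intro conjI ballI)
  fix K assume "K \<in> conn_sets X"
  then have "K \<in> generated_structure (points X) (generic_points X)"
    using assms(1,2) conn_sets_generated_by_generic_points by blast
  moreover have "connectivity_structure (points Y) (conn_sets Y)"
    using assms(3) by (simp add: connectivity_space_def)
  moreover have "generic_points X \<subseteq> Pow (points X)"
    using assms(1) generic_points_subset by blast
  ultimately show "f ` K \<in> conn_sets Y"
    using image_generated_structure[OF _ assms(4)] assms(5) by blast
qed fact

section \<open>Reconstruction of a space from its ordered generic points\<close>

text \<open>Since \<open>x\<close> lies in \<open>g\<close> exactly when \<open>{x}\<close> is
  included in \<open>g\<close>, membership is encoded in the order, and \<open>\<phi>\<close> is
  determined by its values on singletons.\<close>

lemma conn_isomorphic_if_generic_points_order_iso:
  assumes X: "connectivity_space X" "finite_space X" "integral_space X"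
    and Y: "connectivity_space Y" "finite_space Y" "integral_space Y"
    and bij: "bij_betw \<phi> (generic_points X) (generic_points Y)"
    and ord: "\<And>g h. g \<in> generic_points X \<Longrightarrow> h \<in> generic_points X \<Longrightarrow> \<phi> g \<subseteq> \<phi> h \<longleftrightarrow> g \<subseteq> h"
  shows "conn_isomorphic X Y"
proof -
  have \<phi>_generic: "\<phi> g \<in> generic_points Y" if "g \<in> generic_points X" for g
    using bij that by (auto simp: bij_betw_def)
  have singleton_X: "{x} \<in> generic_points X" if "x \<in> points X" for x
    using singleton_generic_point[OF X(1,3) that] .
  have singleton_Y: "\<exists>k\<in>generic_points X. \<phi> k = {y}" if "y \<in> points Y" for y
    using singleton_generic_point[OF Y(1,3) that] bij_betw_imp_surj_on[OF bij]
    by (metis imageE)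
  \<comment> \<open>Any point \<open>y\<close> of \<open>\<phi> {x}\<close> will do: the preimage
    \<open>k\<close> of \<open>{y}\<close> lies below \<open>{x}\<close> because
    \<open>\<phi>\<close> reflects inclusion, and being nonempty it equals
    \<open>{x}\<close>.\<close>
  have "\<exists>y. \<phi> {x} = {y}" if x: "x \<in> points X" for x
  proof -
    obtain y where y: "y \<in> \<phi> {x}"
      using generic_points_nonempty[OF \<phi>_generic[OF singleton_X[OF x]]] by blast
    then have "y \<in> points Y"
      using generic_points_subset[OF Y(1) \<phi>_generic[OF singleton_X[OF x]]] by blast
    then obtain k where k: "k \<in> generic_points X" "\<phi> k = {y}"
      using singleton_Y by blast
    with y have "\<phi> k \<subseteq> \<phi> {x}" by simp
    then have "k \<subseteq> {x}"
      using ord[OF k(1) singleton_X[OF x]] by blast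
    then have "k = {x}"
      using generic_points_nonempty[OF k(1)] by blast
    with k(2) show ?thesis by blast
  qed
  then obtain f where f: "\<And>x. x \<in> points X \<Longrightarrow> \<phi> {x} = {f x}"
    by metis
  have image: "f ` g = \<phi> g" if g: "g \<in> generic_points X" for g
  proof
    show "f ` g \<subseteq> \<phi> g"
    proof
      fix y assume "y \<in> f ` g"
      then obtain x where x: "x \<in> g" "y = f x" by blast
      then have xX: "x \<in> points X"
        using generic_points_subset[OF X(1) g] by blast
      have "\<phi> {x} \<subseteq> \<phi> g"
        using ord[OF singleton_X[OF xX] g] x(1) by blast
      then show "y \<in> \<phi> g"
        using f[OF xX] x(2) by simp
    qed
    show "\<phi> g \<subseteq> f ` g"
    proof
      fix y assume y: "y \<in> \<phi> g"
      then have "y \<in> points Y"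
        using generic_points_subset[OF Y(1) \<phi>_generic[OF g]] by blast
      then obtain k where k: "k \<in> generic_points X" "\<phi> k = {y}"
        using singleton_Y by blast
      with y have "k \<subseteq> g"
        using ord[OF k(1) g] by simp
      \<comment> \<open>Every point \<open>x\<close> of \<open>k\<close> is mapped to
        \<open>y\<close>, because \<open>\<phi> {x}\<close> lies below
        \<open>\<phi> k = {y}\<close>; no prior knowledge that \<open>k\<close> is a singleton
        enters.\<close>
      obtain x where x: "x \<in> k"
        using generic_points_nonempty[OF k(1)] by blast
      then have xX: "x \<in> points X"
        using generic_points_subset[OF X(1) k(1)] by blast
      have "\<phi> {x} \<subseteq> {y}"
        using ord[OF singleton_X[OF xX] k(1)] x k(2) by simp
      then have "f x = y"
        using f[OF xX] by blast
      with x \<open>k \<subseteq> g\<close> show "y \<in> f ` g" by blast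
    qed
  qed
  have inj: "inj_on f (points X)"
  proof (rule inj_onI)
    fix x x' assume xx': "x \<in> points X" "x' \<in> points X" "f x = f x'"
    then have "\<phi> {x} \<subseteq> \<phi> {x'}"
      using f by simp
    then show "x = x'"
      using ord singleton_X xx'(1,2) by blast
  qed
  have surj: "f ` points X = points Y"
  proof
    show "f ` points X \<subseteq> points Y"
      using f \<phi>_generic[OF singleton_X] generic_points_subset[OF Y(1)] by fastforce
    show "points Y \<subseteq> f ` points X"
    proof
      fix y assume "y \<in> points Y"
      then obtain k where k: "k \<in> generic_points X" "\<phi> k = {y}"
        using singleton_Y by blast
      then show "y \<in> f ` points X"
        using image[OF k(1)] generic_points_subset[OF X(1) k(1)] by blast
    qed
  qed
  let ?f' = "the_inv_into (points X) f"
  have "conn_morphism X Y f"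
    using X(1,2) Y(1)
  proof (rule conn_morphism_if_generic_points)
    show "f ` points X \<subseteq> points Y" using surj by simp
    show "f ` g \<in> conn_sets Y" if "g \<in> generic_points X" for g
      using image[OF that] \<phi>_generic[OF that] generic_points_conn_sets by auto
  qed
  moreover have "conn_morphism Y X ?f'"
    using Y(1,2) X(1)
  proof (rule conn_morphism_if_generic_points)
    show "?f' ` points Y \<subseteq> points X"
      using the_inv_into_onto[OF inj] surj by simp
    show "?f' ` h \<in> conn_sets X" if h: "h \<in> generic_points Y" for h
    proof -
      \<comment> \<open>As \<open>\<phi> g\<close> is the direct image of \<open>g\<close>, the
        inverse of \<open>f\<close> carries \<open>h\<close> back to \<open>g\<close>, which is
        connected.\<close>
      obtain g where g: "g \<in> generic_points X" "h = \<phi> g"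
        using h bij_betw_imp_surj_on[OF bij] by blast
      have "?f' ` f ` g = g"
        using the_inv_into_f_f[OF inj] generic_points_subset[OF X(1) g(1)]
        by (force simp: image_image)
      then show ?thesis
        using g image[OF g(1)] subsetD[OF generic_points_conn_sets g(1)] by simp
    qed
  qed
  ultimately show ?thesis
    using inj surj unfolding conn_isomorphic_def conn_isomorphism_def bij_betw_def by blast
qed

section \<open>The generic graph and isomorphism of directed graphs\<close>

lemma wf_digraph_generic_graph: "wf_digraph (with_proj (generic_graph X))"
  by unfold_locales (auto simp: generic_graph_def)

lemma pverts_generic_graph: "pverts (generic_graph X) = generic_points X"
  by (simp add: generic_graph_def)

lemma parcs_generic_graph_iff:
  "(g, h) \<in> parcs (generic_graph X) \<longleftrightarrow>
     g \<in> generic_points X \<and> h \<in> generic_points X \<and> h \<subset> g \<and>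
     (\<nexists>k. k \<in> generic_points X \<and> h \<subset> k \<and> k \<subset> g)"
  by (simp add: generic_graph_def)

text \<open>In a graph of the form \<open>with_proj G\<close> an arc is the pair of its ends, so the
  arc component of an isomorphism is forced by the vertex component. What remains is a vertex
  bijection that preserves and reflects adjacency.\<close>

lemma digraph_iso_with_proj_iff:
  assumes G: "wf_digraph (with_proj G)" and H: "wf_digraph (with_proj H)"
  shows "digraph_iso (with_proj G) (with_proj H) \<longleftrightarrow>
    (\<exists>f. bij_betw f (pverts G) (pverts H) \<and>
      (\<forall>u\<in>pverts G. \<forall>v\<in>pverts G. (u, v) \<in> parcs G \<longleftrightarrow> (f u, f v) \<in> parcs H))"
    (is "?L \<longleftrightarrow> (\<exists>f. ?P f)")
proof
  have arcs_G: "u \<in> pverts G \<and> v \<in> pverts G" if "(u, v) \<in> parcs G" for u v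
    using wf_digraph.tail_in_verts[OF G] wf_digraph.head_in_verts[OF G] that by fastforce
  have arcs_H: "u \<in> pverts H \<and> v \<in> pverts H" if "(u, v) \<in> parcs H" for u v
    using wf_digraph.tail_in_verts[OF H] wf_digraph.head_in_verts[OF H] that by fastforce
  {
    assume ?L
    then obtain F where F: "pre_digraph.digraph_isomorphism (with_proj G) F"
      and eq: "with_proj H = app_iso F (with_proj G)"
      by (auto simp: digraph_iso_def)
    let ?f = "iso_verts F"
    have inj: "inj_on ?f (pverts G)"
      using pre_digraph.digraph_isomorphism_inj_on_verts[OF F] by simp
    have verts: "pverts H = ?f ` pverts G"
      using arg_cong[OF eq, of verts] by simp
    \<comment> \<open>\<open>app_iso\<close> installs the tail and head maps carried by
      \<open>F\<close>; those of \<open>with_proj H\<close> are the projections.\<close>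
    have tail: "iso_tail F = fst" and head: "iso_head F = snd"
      using arg_cong[OF eq, of tail] arg_cong[OF eq, of head] by simp_all
    have "iso_arcs F (u, v) = (?f u, ?f v)" if "(u, v) \<in> parcs G" for u v
      using pre_digraph.iso_verts_tail[OF F, of "(u, v)"]
        pre_digraph.iso_verts_head[OF F, of "(u, v)"] that
      by (simp add: tail head prod_eq_iff)
    then have "iso_arcs F ` parcs G = (\<lambda>(u, v). (?f u, ?f v)) ` parcs G"
      by (intro image_cong) auto
    then have arcs: "parcs H = (\<lambda>(u, v). (?f u, ?f v)) ` parcs G"
      using arg_cong[OF eq, of arcs] by simp
    have "(u, v) \<in> parcs G \<longleftrightarrow> (?f u, ?f v) \<in> parcs H" if uv: "u \<in> pverts G" "v \<in> pverts G" for u v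
    proof
      assume "(u, v) \<in> parcs G"
      then show "(?f u, ?f v) \<in> parcs H"
        unfolding arcs by force
    next
      assume "(?f u, ?f v) \<in> parcs H"
      then obtain a b where ab: "(a, b) \<in> parcs G" "?f u = ?f a" "?f v = ?f b"
        unfolding arcs by auto
      \<comment> \<open>Well-formedness makes \<open>a\<close> and \<open>b\<close> vertices, where
        the vertex map is injective.\<close>
      then have "u = a" "v = b"
        using inj_onD[OF inj] arcs_G[OF ab(1)] uv by blast+
      with ab(1) show "(u, v) \<in> parcs G" by simp
    qed
    then show "\<exists>f. ?P f"
      using inj verts by (intro exI[of _ ?f]) (simp add: bij_betw_def)
  next
    assume "\<exists>f. ?P f"
    then obtain f where bij: "bij_betw f (pverts G) (pverts H)"
      and iff: "\<And>u v. u \<in> pverts G \<Longrightarrow> v \<in> pverts G \<Longrightarrow>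
        (u, v) \<in> parcs G \<longleftrightarrow> (f u, f v) \<in> parcs H"
      by blast
    have inj: "inj_on f (pverts G)" and verts: "f ` pverts G = pverts H"
      using bij by (auto simp: bij_betw_def)
    \<comment> \<open>The arc map applies \<open>f\<close> to both ends, and the projections again
      serve as head and tail in the target.\<close>
    let ?F = "\<lparr>iso_verts = f, iso_arcs = (\<lambda>(u, v). (f u, f v)), iso_head = snd, iso_tail = fst\<rparr>"
    have "inj_on (\<lambda>(u, v). (f u, f v)) (parcs G)"
      using inj arcs_G by (auto simp: inj_on_def dest!: arcs_G)
    then have "pre_digraph.digraph_isomorphism (with_proj G) ?F"
      using G inj by (auto simp: pre_digraph.digraph_isomorphism_def)
    moreover have "(\<lambda>(u, v). (f u, f v)) ` parcs G = parcs H"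
    proof
      show "(\<lambda>(u, v). (f u, f v)) ` parcs G \<subseteq> parcs H"
        using arcs_G iff by auto
      show "parcs H \<subseteq> (\<lambda>(u, v). (f u, f v)) ` parcs G"
      proof
        fix e assume e: "e \<in> parcs H"
        obtain u v where uv: "e = (f u, f v)" "u \<in> pverts G" "v \<in> pverts G"
          using arcs_H e verts by (cases e) blast
        then show "e \<in> (\<lambda>(u, v). (f u, f v)) ` parcs G"
          using e iff by (auto intro!: image_eqI[where x = "(u, v)"])
      qed
    qed
    then have "with_proj H = app_iso ?F (with_proj G)"
      using verts by (simp add: app_iso_def with_proj_def)
    ultimately show ?L
      unfolding digraph_iso_def by blast
  }
qed

section \<open>Recovering inclusion from the generic graph\<close>

text \<open>Arcs are covering pairs, and by finiteness every proper inclusion refines to a chain of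
  them. Only preservation of arcs is assumed, so the result can be applied to a graph isomorphism
  and to its inverse.\<close>

lemma generic_graph_hom_strict_mono:
  assumes X: "connectivity_space X" "finite_space X"
    and hom: "\<And>g h. (g, h) \<in> parcs (generic_graph X) \<Longrightarrow> (\<phi> g, \<phi> h) \<in> parcs (generic_graph Y)"
    and "g \<in> generic_points X" "h \<in> generic_points X" "h \<subset> g"
  shows "\<phi> h \<subset> \<phi> g"
  using assms(4-6)
proof (induction "card (g - h)" arbitrary: g h rule: less_induct)
  case less
  show ?case
  proof (cases "(g, h) \<in> parcs (generic_graph X)")
    case True
    then show ?thesis
      using hom by (auto simp: parcs_generic_graph_iff)
  next
    case False
    then obtain k where k: "k \<in> generic_points X" "h \<subset> k" "k \<subset> g"
      using less.prems by (auto simp: parcs_generic_graph_iff)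
    have "finite g"
      using generic_points_subset[OF X(1) less.prems(1)] X(2) finite_subset
      by (auto simp: finite_space_def)
    \<comment> \<open>Both \<open>g - k\<close> and \<open>k - h\<close> are proper subsets of
      \<open>g - h\<close>, since \<open>k\<close> lies strictly between \<open>h\<close> and
      \<open>g\<close>.\<close>
    then have "card (g - k) < card (g - h)" "card (k - h) < card (g - h)"
      using k by (auto intro!: psubset_card_mono)
    then have "\<phi> k \<subset> \<phi> g" "\<phi> h \<subset> \<phi> k"
      using less k by blast+
    then show ?thesis by blast
  qed
qed

text \<open>Strict monotonicity of \<open>\<phi>\<close> preserves inclusion, and that of its
  inverse reflects it; injectivity settles the case of equal images.\<close>

lemma generic_graph_iso_order_iso:
  assumes X: "connectivity_space X" "finite_space X"
    and Y: "connectivity_space Y" "finite_space Y"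
    and bij: "bij_betw \<phi> (generic_points X) (generic_points Y)"
    and arcs: "\<And>g h. g \<in> generic_points X \<Longrightarrow> h \<in> generic_points X \<Longrightarrow>
      (g, h) \<in> parcs (generic_graph X) \<longleftrightarrow> (\<phi> g, \<phi> h) \<in> parcs (generic_graph Y)"
    and g: "g \<in> generic_points X" and h: "h \<in> generic_points X"
  shows "\<phi> g \<subseteq> \<phi> h \<longleftrightarrow> g \<subseteq> h"
proof -
  let ?\<psi> = "the_inv_into (generic_points X) \<phi>"
  have inj: "inj_on \<phi> (generic_points X)"
    using bij by (simp add: bij_betw_def)
  have \<phi>_generic: "\<phi> k \<in> generic_points Y" if "k \<in> generic_points X" for k
    using bij that by (auto simp: bij_betw_def)
  have \<psi>\<phi>: "?\<psi> (\<phi> k) = k" if "k \<in> generic_points X" for k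
    using the_inv_into_f_f[OF inj that] .
  have hom: "(\<phi> k, \<phi> l) \<in> parcs (generic_graph Y)" if "(k, l) \<in> parcs (generic_graph X)" for k l
    using that arcs[of k l] by (simp add: parcs_generic_graph_iff)
  \<comment> \<open>The ends of an arc of the second graph are images of generic points of
    \<open>X\<close>, so \<open>arcs\<close> can be read backwards.\<close>
  have hom': "(?\<psi> k, ?\<psi> l) \<in> parcs (generic_graph X)"
    if kl: "(k, l) \<in> parcs (generic_graph Y)" for k l
  proof -
    have "k \<in> \<phi> ` generic_points X" "l \<in> \<phi> ` generic_points X"
      using bij kl by (simp_all add: bij_betw_def parcs_generic_graph_iff)
    then obtain k' l' where "k' \<in> generic_points X" "k = \<phi> k'" "l' \<in> generic_points X" "l = \<phi> l'"
      by blast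
    then show ?thesis
      using arcs kl \<psi>\<phi> by simp
  qed
  show ?thesis
  proof
    assume "\<phi> g \<subseteq> \<phi> h"
    then consider "\<phi> g = \<phi> h" | "\<phi> g \<subset> \<phi> h" by blast
    then show "g \<subseteq> h"
    proof cases
      case 1
      then show ?thesis using inj_onD[OF inj _ g h] by blast
    next
      case 2
      have "?\<psi> (\<phi> g) \<subset> ?\<psi> (\<phi> h)"
        using generic_graph_hom_strict_mono[OF Y hom' \<phi>_generic[OF h] \<phi>_generic[OF g] 2] .
      then show ?thesis using \<psi>\<phi> g h by auto
    qed
  next
    assume "g \<subseteq> h"
    then show "\<phi> g \<subseteq> \<phi> h"
      using generic_graph_hom_strict_mono[where \<phi> = \<phi>, OF X hom h g] by blast
  qed
qed

section \<open>Generic points under isomorphisms of spaces\<close>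

text \<open>Reducibility travels back along \<open>f'\<close>: if other connected sets generate the
  image of \<open>g\<close>, their images under \<open>f'\<close> generate \<open>g\<close>.\<close>

lemma generic_point_image:
  assumes X: "connectivity_space X" and Y: "connectivity_space Y"
    and f: "conn_morphism X Y f" and f': "conn_morphism Y X f'"
    and f'f: "\<And>x. x \<in> points X \<Longrightarrow> f' (f x) = x"
    and ff': "\<And>y. y \<in> points Y \<Longrightarrow> f (f' y) = y"
    and g: "g \<in> generic_points X"
  shows "f ` g \<in> generic_points Y"
proof -
  have g_conn: "g \<in> conn_sets X"
    using g generic_points_conn_sets by blast
  have f'_image: "f' ` f ` K = K" if "K \<subseteq> points X" for K
    using that f'f by (force simp: image_image)
  have f_image: "f ` f' ` L = L" if "L \<subseteq> points Y" for L
    using that ff' by (force simp: image_image)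
  have "\<not> conn_reducible Y (f ` g)"
  proof
    assume red: "conn_reducible Y (f ` g)"
    let ?\<G> = "generated_structure (points X) (conn_sets X - {g})"
    have "f' ` f ` g \<in> ?\<G>"
    proof (rule image_generated_structure)
      show "connectivity_structure (points X) ?\<G>"
        using X conn_sets_subset by (intro connectivity_structure_generated) blast
      show "f' ` points Y \<subseteq> points X"
        using f' by (simp add: conn_morphism_def)
      show "conn_sets Y - {f ` g} \<subseteq> Pow (points Y)"
        using Y conn_sets_subset by blast
      show "f ` g \<in> generated_structure (points Y) (conn_sets Y - {f ` g})"
        using red by (simp add: conn_reducible_def)
      fix L assume L: "L \<in> conn_sets Y - {f ` g}"
      \<comment> \<open>If \<open>f'\<close> sent \<open>L\<close> onto \<open>g\<close>, then
        \<open>L\<close> would be the image of \<open>g\<close> under \<open>f\<close>, which is the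
        excluded generator.\<close>
      then have "f ` f' ` L = L"
        by (intro f_image conn_sets_subset[OF Y]) simp
      with L have "f' ` L \<noteq> g" by blast
      moreover have "f' ` L \<in> conn_sets X"
        using L f' by (simp add: conn_morphism_def)
      ultimately show "f' ` L \<in> ?\<G>"
        by (intro subsetD[OF generated_structure_contains]) simp
    qed
    then have "conn_reducible X g"
      using f'_image[OF conn_sets_subset[OF X g_conn]] g_conn by (simp add: conn_reducible_def)
    then show False
      using g by (simp add: generic_points_def conn_irreducible_def)
  qed
  then show ?thesis
    using f g_conn generic_points_nonempty[OF g]
    by (auto simp: generic_points_def conn_irreducible_def conn_morphism_def)
qed

text \<open>The vertex map is direct image under \<open>f\<close>: it is a bijection of generic
  points that preserves and reflects proper inclusion, hence also the covering relation.\<close>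

lemma generic_graph_iso_if_conn_isomorphic:
  assumes X: "connectivity_space X" and Y: "connectivity_space Y" and "conn_isomorphic X Y"
  shows "digraph_iso (with_proj (generic_graph X)) (with_proj (generic_graph Y))"
proof -
  obtain f where bij: "bij_betw f (points X) (points Y)" and f: "conn_morphism X Y f"
    and f': "conn_morphism Y X (the_inv_into (points X) f)" (is "conn_morphism Y X ?f'")
    using assms(3) by (auto simp: conn_isomorphic_def conn_isomorphism_def)
  have inj: "inj_on f (points X)" and surj: "f ` points X = points Y"
    using bij by (auto simp: bij_betw_def)
  have f'f: "?f' (f x) = x" if "x \<in> points X" for x
    using the_inv_into_f_f[OF inj that] .
  have ff': "f (?f' y) = y" if "y \<in> points Y" for y
    using f_the_inv_into_f[OF inj] that surj by blast
  have f_generic: "f ` g \<in> generic_points Y" if "g \<in> generic_points X" for g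
    using generic_point_image[OF X Y f f' f'f ff' that] .
  have f'_generic: "?f' ` h \<in> generic_points X" if "h \<in> generic_points Y" for h
    using generic_point_image[OF Y X f' f ff' f'f that] .
  have image_f': "f ` ?f' ` h = h" if "h \<in> generic_points Y" for h
    using generic_points_subset[OF Y that] ff' by (force simp: image_image)
  have bij_generic: "bij_betw ((`) f) (generic_points X) (generic_points Y)"
    unfolding bij_betw_def
  proof
    show "inj_on ((`) f) (generic_points X)"
      using inj_on_image_Pow[OF inj] generic_points_subset[OF X] by (auto intro: inj_on_subset)
    show "(`) f ` generic_points X = generic_points Y"
    proof
      show "(`) f ` generic_points X \<subseteq> generic_points Y"
        using f_generic by blast
      show "generic_points Y \<subseteq> (`) f ` generic_points X"
        using f'_generic image_f' by (metis image_eqI subsetI)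
    qed
  qed
  have subset: "f ` K \<subseteq> f ` L \<longleftrightarrow> K \<subseteq> L" if "K \<subseteq> points X" "L \<subseteq> points X" for K L
    using inj_on_image_mem_iff[OF inj _ that(2)] that(1) by (simp add: image_subset_iff subset_eq)
  have psubset: "f ` h \<subset> f ` g \<longleftrightarrow> h \<subset> g"
    if "g \<in> generic_points X" "h \<in> generic_points X" for g h
    using subset generic_points_subset[OF X] that by (simp add: less_le_not_le)
  have "(g, h) \<in> parcs (generic_graph X) \<longleftrightarrow> (f ` g, f ` h) \<in> parcs (generic_graph Y)"
    if g: "g \<in> generic_points X" and h: "h \<in> generic_points X" for g h
  proof -
    \<comment> \<open>Each candidate strictly between the two images is itself the image of a
      generic point of \<open>X\<close>, so the absence of intermediate points transfers both
      ways.\<close>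
    have "(\<exists>k\<in>generic_points Y. f ` h \<subset> k \<and> k \<subset> f ` g) \<longleftrightarrow>
        (\<exists>k\<in>(`) f ` generic_points X. f ` h \<subset> k \<and> k \<subset> f ` g)"
      using bij_generic by (simp add: bij_betw_def)
    also have "\<dots> \<longleftrightarrow> (\<exists>k\<in>generic_points X. h \<subset> k \<and> k \<subset> g)"
      using psubset g h by simp
    finally show ?thesis
      using g h f_generic psubset by (simp add: parcs_generic_graph_iff Bex_def)
  qed
  then show ?thesis
    unfolding digraph_iso_with_proj_iff[OF wf_digraph_generic_graph wf_digraph_generic_graph]
      pverts_generic_graph
    using bij_generic by blast
qed

theorem proposition16:
  fixes X :: "'a conn_space" and Y :: "'b conn_space"
  assumes "connectivity_space X" and "finite_space X" and "integral_space X"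
    and "connectivity_space Y" and "finite_space Y" and "integral_space Y"
  shows "conn_isomorphic X Y \<longleftrightarrow>
    digraph_iso (with_proj (generic_graph X)) (with_proj (generic_graph Y))"
proof
  assume "conn_isomorphic X Y"
  then show "digraph_iso (with_proj (generic_graph X)) (with_proj (generic_graph Y))"
    using generic_graph_iso_if_conn_isomorphic assms(1,4) by blast
next
  assume "digraph_iso (with_proj (generic_graph X)) (with_proj (generic_graph Y))"
  then obtain \<phi> where bij: "bij_betw \<phi> (generic_points X) (generic_points Y)"
    and arcs: "\<And>g h. g \<in> generic_points X \<Longrightarrow> h \<in> generic_points X \<Longrightarrow>
      (g, h) \<in> parcs (generic_graph X) \<longleftrightarrow> (\<phi> g, \<phi> h) \<in> parcs (generic_graph Y)"
    unfolding digraph_iso_with_proj_iff[OF wf_digraph_generic_graph wf_digraph_generic_graph]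
      pverts_generic_graph
    by blast
  \<comment> \<open>The vertex bijection \<open>\<phi>\<close> respects arcs, hence inclusion, and
    an order isomorphism of generic points yields an isomorphism of spaces.\<close>
  show "conn_isomorphic X Y"
    using conn_isomorphic_if_generic_points_order_iso[OF assms bij]
      generic_graph_iso_order_iso[OF assms(1,2,4,5) bij arcs] by blast
qed

end
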